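(* Let $t_0>0$, $\alpha>0$, $\delta>0$, $\sigma\ge0$, $\mu>0$ with $2\le\frac1\delta<\alpha-1$, and $\beta(t)=\mu t^{1/\delta-2}$. Let $\epsilon:[t_0,+\infty)\to\mathcal H_1$ satisfy $\int_{t_0}^{+\infty}t\|\epsilon(t)\|\,dt<+\infty$. Let $(x(t),\lambda(t))$ be a global solution on $[t_0,+\infty)$ of $$\begin{cases}\ddot x(t)+\frac{\alpha}{t}\dot x(t)=-\beta(t)\big(\nabla f(x(t))+A^T(\lambda(t)+\delta t\dot\lambda(t))+\sigma A^T(Ax(t)-b)\big)+\epsilon(t),\\ \ddot\lambda(t)+\frac{\alpha}{t}\dot\lambda(t)=\beta(t)\big(A(x(t)+\delta t\dot x(t))-b\big).\end{cases}$$ Then for any $(x^*,\lambda^* )\in\Omega$, $$|f(x(t))-f(x^* )|=\mathcal O\Big(\frac1{t^{1/\delta}}\Big),\qquad \|Ax(t)-b\|=\mathcal O\Big(\frac1{t^{1/\delta}}\Big).$$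
   Context: $\mathcal H_1,\mathcal H_2$ are real Hilbert spaces, $A:\mathcal H_1\to\mathcal H_2$ is a continuous linear operator with adjoint $A^T$, $b\in\mathcal H_2$, and $f:\mathcal H_1\to\mathbb R$ is convex and continuously differentiable. $\Omega\subset\mathcal H_1\times\mathcal H_2$ is the set of saddle points of the Lagrangian $\mathcal L(x,\lambda)=f(x)+\langle\lambda,Ax-b\rangle$, equivalently the set of pairs $(x^*,\lambda^* )$ with $\nabla f(x^* )=-A^T\lambda^*$ and $Ax^*=b$; it is assumed nonempty. A global solution of the system is a pair $(x,\lambda)$ with $x\in\mathcal C^2([t_0,+\infty),\mathcal H_1)$, $\lambda\in\mathcal C^2([t_0,+\infty),\mathcal H_2)$, such that $(x,\lambda)$ and $(\dot x,\dot\lambda)$ are locally absolutely continuous and the system holds for almost every $t\ge t_0$. All $\mathcal O(\cdot)$ are as $t\to+\infty$. *)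

theory Defs
  imports "HOL-Analysis.Analysis" "HOL-Library.Landau_Symbols"
begin

section \<open>Gradients\<close>

(* Continuity of the Frechet derivative is with respect to the operator norm. *)
definition continuously_differentiable :: "('a::real_normed_vector \<Rightarrow> real) \<Rightarrow> bool" where
  "continuously_differentiable f \<longleftrightarrow>
     (\<exists>f' :: 'a \<Rightarrow> 'a \<Rightarrow>\<^sub>L real.
        (\<forall>x. (f has_derivative blinfun_apply (f' x)) (at x)) \<and> continuous_on UNIV f')"

(* Existence for a differentiable f on a Hilbert space is the Riesz representation theorem;
   the same theorem guarantees that the library constant "adjoint" is meaningful. *)
definition gradient :: "('a::real_inner \<Rightarrow> real) \<Rightarrow> 'a \<Rightarrow> 'a" where
  "gradient f x = (THE D. GDERIV f x :> D)"

section \<open>Saddle points of the Lagrangian\<close>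

definition lagrangian ::
  "('a::real_inner \<Rightarrow> real) \<Rightarrow> ('a \<Rightarrow> 'b::real_inner) \<Rightarrow> 'b \<Rightarrow> 'a \<Rightarrow> 'b \<Rightarrow> real" where
  "lagrangian f A b x l = f x + l \<bullet> (A x - b)"

definition saddle_points ::
  "('a::real_inner \<Rightarrow> real) \<Rightarrow> ('a \<Rightarrow> 'b::real_inner) \<Rightarrow> 'b \<Rightarrow> ('a \<times> 'b) set" where
  "saddle_points f A b =
     {(xs, ls). \<forall>x l. lagrangian f A b xs l \<le> lagrangian f A b xs ls \<and>
                      lagrangian f A b xs ls \<le> lagrangian f A b x ls}"

section \<open>Trajectories on a closed half-line\<close>

(* One-sided at t0, so only the values of u on [t0, \<infinity>) matter. *)
definition ray_deriv :: "real \<Rightarrow> (real \<Rightarrow> 'a::real_normed_vector) \<Rightarrow> real \<Rightarrow> 'a" where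
  "ray_deriv t0 u t = vector_derivative u (at t within {t0..})"

definition C2_on_ray :: "real \<Rightarrow> (real \<Rightarrow> 'a::real_normed_vector) \<Rightarrow> bool" where
  "C2_on_ray t0 u \<longleftrightarrow>
     u differentiable_on {t0..} \<and>
     ray_deriv t0 u differentiable_on {t0..} \<and>
     continuous_on {t0..} (ray_deriv t0 (ray_deriv t0 u))"

(* P is a finite family of non-overlapping subintervals [u, v] of [a, b], given by their endpoints. *)
definition absolutely_continuous_on_interval ::
  "real \<Rightarrow> real \<Rightarrow> (real \<Rightarrow> 'a::real_normed_vector) \<Rightarrow> bool" where
  "absolutely_continuous_on_interval a b g \<longleftrightarrow>
     (\<forall>e>0. \<exists>d>0. \<forall>P :: (real \<times> real) set.
        finite P \<and>
        (\<forall>(u, v)\<in>P. a \<le> u \<and> u \<le> v \<and> v \<le> b) \<and>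
        pairwise (\<lambda>p q. {fst p<..<snd p} \<inter> {fst q<..<snd q} = {}) P \<and>
        (\<Sum>(u, v)\<in>P. v - u) < d
        \<longrightarrow> (\<Sum>(u, v)\<in>P. norm (g v - g u)) < e)"

definition locally_absolutely_continuous_on_ray ::
  "real \<Rightarrow> (real \<Rightarrow> 'a::real_normed_vector) \<Rightarrow> bool" where
  "locally_absolutely_continuous_on_ray t0 g \<longleftrightarrow>
     (\<forall>a b. t0 \<le> a \<and> a \<le> b \<longrightarrow> absolutely_continuous_on_interval a b g)"

section \<open>The primal-dual dynamical system\<close>

definition global_solution ::
  "real \<Rightarrow> real \<Rightarrow> real \<Rightarrow> real \<Rightarrow> (real \<Rightarrow> real) \<Rightarrow>
   ('a::real_inner \<Rightarrow> real) \<Rightarrow> ('a \<Rightarrow> 'b::real_inner) \<Rightarrow> 'b \<Rightarrow> (real \<Rightarrow> 'a) \<Rightarrow>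
   (real \<Rightarrow> 'a) \<Rightarrow> (real \<Rightarrow> 'b) \<Rightarrow> bool" where
  "global_solution t0 \<alpha> \<delta> \<sigma> \<beta> f A b \<epsilon> x l \<longleftrightarrow>
     C2_on_ray t0 x \<and> C2_on_ray t0 l \<and>
     locally_absolutely_continuous_on_ray t0 (\<lambda>t. (x t, l t)) \<and>
     locally_absolutely_continuous_on_ray t0 (\<lambda>t. (ray_deriv t0 x t, ray_deriv t0 l t)) \<and>
     (AE t in lebesgue. t \<ge> t0 \<longrightarrow>
        ray_deriv t0 (ray_deriv t0 x) t + (\<alpha> / t) *\<^sub>R ray_deriv t0 x t =
          - (\<beta> t *\<^sub>R (gradient f (x t) + adjoint A (l t + (\<delta> * t) *\<^sub>R ray_deriv t0 l t)
                     + \<sigma> *\<^sub>R adjoint A (A (x t) - b))) + \<epsilon> t \<and>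
        ray_deriv t0 (ray_deriv t0 l) t + (\<alpha> / t) *\<^sub>R ray_deriv t0 l t =
          \<beta> t *\<^sub>R (A (x t + (\<delta> * t) *\<^sub>R ray_deriv t0 x t) - b))"

end

theory Submission
  imports Defs
begin

text \<open>
  Write \<open>u = x - xs + \<delta> t x'\<close>, \<open>v = l - ls + \<delta> t l'\<close> and let \<open>gap\<close> be the duality gap of the
  augmented Lagrangian at \<open>ls\<close>. For the energy
  \<open>\<delta>\<^sup>2 \<mu> t\<^bsup>1/\<delta>\<^esup> gap (x) + \<bar>u\<bar>\<^sup>2 / 2 + \<bar>v\<bar>\<^sup>2 / 2 + \<eta> \<bar>x - xs\<bar>\<^sup>2 / 2 + \<eta> \<bar>l - ls\<bar>\<^sup>2 / 2\<close> with
  \<open>\<eta> = \<delta> \<alpha> - \<delta> - 1 > 0\<close>, the primal-dual coupling terms cancel, and the scaling \<open>\<beta>\<close> is exactly the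
  one for which the growth of \<open>t\<^bsup>1/\<delta>\<^esup>\<close> is absorbed by convexity; hence its derivative is at most
  \<open>\<delta> t \<bar>\<epsilon>\<bar> \<bar>u\<bar>\<close> and the energy stays bounded. This bounds \<open>t\<^bsup>1/\<delta>\<^esup> gap (x)\<close>, \<open>l\<close> and \<open>t l'\<close>.
  The rate for the constraint comes from the dual equation: \<open>t\<close> times it says that
  \<open>t l' + (\<alpha> - 1) l - \<mu> \<delta> t\<^bsup>1/\<delta>\<^esup> (A x - b)\<close> is constant. Because \<open>x\<close> is twice continuously
  differentiable, \<open>\<epsilon>\<close> agrees almost everywhere with a continuous function for which the system
  holds at every time, so only classical calculus is involved.
\<close>

section \<open>Adjoints and gradients in Hilbert spaces\<close>

text \<open>The representing vector is found as the minimiser of the quadratic functional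
  \<open>J\<close>. The parallelogram identity makes a minimising sequence Cauchy, completeness
  gives its limit \<open>z\<close>, and minimality of \<open>J\<close> along each line through
  \<open>z\<close> is the claimed identity.\<close>

lemma riesz_representation:
  fixes \<phi> :: "'a::{real_inner, complete_space} \<Rightarrow> real"
  assumes "bounded_linear \<phi>"
  obtains z where "\<And>h. \<phi> h = h \<bullet> z"
proof -
  interpret \<phi>: bounded_linear \<phi> by fact
  define J where "J h = h \<bullet> h / 2 - \<phi> h" for h
  define m where "m = Inf (range J)"
  obtain K where K: "\<And>h. norm (\<phi> h) \<le> norm h * K"
    using \<phi>.bounded by blast
  have lower: "- (K\<^sup>2 / 2) \<le> J h" for h
  proof -
    have "0 \<le> (norm h - K)\<^sup>2" by simp
    then have "norm h * K - K\<^sup>2 / 2 \<le> h \<bullet> h / 2"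
      by (simp add: power2_eq_square dot_square_norm algebra_simps)
    with K[of h] show ?thesis unfolding J_def by (simp add: abs_le_iff)
  qed
  have bdd: "bdd_below (range J)"
    using lower by (intro bdd_belowI2)
  have m: "m \<le> J h" for h
    unfolding m_def using bdd by (intro cInf_lower) auto
  have "\<exists>h. J h < m + 1 / real (Suc n)" for n
    using cInf_lessD[of "range J" "m + 1 / real (Suc n)"] unfolding m_def by auto
  then obtain X where X: "\<And>n. J (X n) < m + 1 / real (Suc n)" by metis
  \<comment> \<open>The midpoint of \<open>h\<close> and \<open>k\<close> also has
    \<open>J\<close>-value at least \<open>m\<close>, so two near-minimisers cannot be far
    apart.\<close>
  have parallelogram: "(norm (h - k))\<^sup>2 \<le> 4 * (J h - m) + 4 * (J k - m)" for h k
  proof -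
    have "J ((1/2) *\<^sub>R (h + k)) = (J h + J k) / 2 - (h - k) \<bullet> (h - k) / 8"
      unfolding J_def
      by (simp add: \<phi>.scaleR \<phi>.add inner_simps inner_commute[of k h] field_simps)
    with m[of "(1/2) *\<^sub>R (h + k)"] show ?thesis
      by (simp add: dot_square_norm field_simps)
  qed
  have "Cauchy X"
  proof (rule CauchyI)
    fix e :: real assume e: "e > 0"
    \<comment> \<open>With this \<open>N\<close> both excesses over \<open>m\<close> are below
      \<open>e^2 / 8\<close>; weighted by 4 each in \<open>parallelogram\<close>, they add up to
      \<open>e^2\<close>.\<close>
    obtain N where N: "8 / e\<^sup>2 < real N"
      using reals_Archimedean2 by blast
    show "\<exists>M. \<forall>p\<ge>M. \<forall>n\<ge>M. norm (X p - X n) < e"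
    proof (intro exI allI impI)
      fix p n assume "p \<ge> N" "n \<ge> N"
      have close: "J (X i) - m < e\<^sup>2 / 8" if "i \<ge> N" for i
      proof -
        have "8 / e\<^sup>2 < real (Suc i)" using N that by simp
        then have "1 / real (Suc i) < e\<^sup>2 / 8"
          using e by (simp add: field_simps)
        with X[of i] show ?thesis by simp
      qed
      have "(norm (X p - X n))\<^sup>2 < e\<^sup>2"
        using parallelogram[of "X p" "X n"] close[OF \<open>p \<ge> N\<close>] close[OF \<open>n \<ge> N\<close>] by simp
      then show "norm (X p - X n) < e"
        using e by (simp add: power2_less_imp_less)
    qed
  qed
  then obtain z where z: "X \<longlonglongrightarrow> z"
    using Cauchy_convergent convergent_def by blast
  have "(\<lambda>n. J (X n)) \<longlonglongrightarrow> J z"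
    unfolding J_def by (intro tendsto_intros z \<phi>.tendsto) auto
  moreover have "(\<lambda>n. m + 1 / real (Suc n)) \<longlonglongrightarrow> m + 0"
    by (intro tendsto_intros LIMSEQ_Suc[OF lim_1_over_n])
  ultimately have "J z \<le> m + 0"
    using X by (intro LIMSEQ_le) (auto intro: less_imp_le)
  then have min: "J z \<le> J h" for h
    using m[of h] by simp
  have "\<phi> h = h \<bullet> z" for h
  proof (cases "h = 0")
    case False
    define c where "c = z \<bullet> h - \<phi> h"
    have pos: "h \<bullet> h > 0" using False by simp
    \<comment> \<open>The step length \<open>- c / (h \<bullet> h)\<close> minimises
      \<open>J\<close> on the line through \<open>z\<close> in direction \<open>h\<close>. The gain
      is quadratic in \<open>c\<close>, so minimality of \<open>z\<close> forces
      \<open>c = 0\<close>.\<close>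
    have "J z \<le> J (z + (- c / (h \<bullet> h)) *\<^sub>R h)" by (rule min)
    also have "\<dots> = J z - c\<^sup>2 / (h \<bullet> h) / 2"
      unfolding J_def c_def using pos
      by (simp add: \<phi>.scaleR \<phi>.add \<phi>.diff inner_simps inner_commute[of h z] field_simps power2_eq_square)
    finally have "c\<^sup>2 \<le> 0" using pos by (simp add: field_simps)
    then show ?thesis by (simp add: c_def inner_commute)
  qed (simp add: \<phi>.zero)
  then show ?thesis by (rule that)
qed

text \<open>The constant \<open>adjoint\<close> is a choice among maps with this property; Riesz
  representation, applied to each \<open>y\<close>, shows that such a map exists.\<close>

lemma inner_adjoint:
  fixes A :: "'a::{real_inner, complete_space} \<Rightarrow> 'b::real_inner"
  assumes "bounded_linear A"
  shows "A x \<bullet> y = x \<bullet> adjoint A y"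
proof -
  have "\<exists>z. \<forall>x. A x \<bullet> y = x \<bullet> z" for y
  proof -
    have "bounded_linear (\<lambda>x. A x \<bullet> y)"
      by (rule bounded_linear_compose[OF bounded_linear_inner_left assms])
    then show ?thesis
      by (rule riesz_representation) blast
  qed
  then obtain B where "\<forall>x y. A x \<bullet> y = x \<bullet> B y" by metis
  then show ?thesis
    using adjoint_unique by metis
qed

lemma bounded_linear_adjoint:
  fixes A :: "'a::{real_inner, complete_space} \<Rightarrow> 'b::real_inner"
  assumes "bounded_linear A"
  shows "bounded_linear (adjoint A)"
proof -
  note adj = inner_adjoint[OF assms, symmetric]
  obtain K where K: "\<And>x. norm (A x) \<le> norm x * K" "K > 0"
    using bounded_linear.pos_bounded[OF assms] by blast
  show ?thesis
  proof (rule bounded_linear_intro)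
    fix y z :: 'b and r :: real
    show "adjoint A (y + z) = adjoint A y + adjoint A z"
      by (subst vector_eq_ldot[symmetric]) (simp add: adj inner_simps)
    show "adjoint A (r *\<^sub>R y) = r *\<^sub>R adjoint A y"
      by (subst vector_eq_ldot[symmetric]) (simp add: adj inner_simps)
    \<comment> \<open>Testing the adjoint identity at \<open>adjoint A y\<close> itself carries the
      bound for \<open>A\<close> over to the adjoint.\<close>
    have "norm (adjoint A y) * norm (adjoint A y) = A (adjoint A y) \<bullet> y"
      by (simp add: inner_adjoint[OF assms] dot_square_norm power2_eq_square)
    also have "\<dots> \<le> norm (A (adjoint A y)) * norm y"
      by (rule norm_cauchy_schwarz)
    also have "\<dots> \<le> norm (adjoint A y) * K * norm y"
      by (intro mult_right_mono K) simp
    finally have "norm (adjoint A y) * norm (adjoint A y) \<le> norm (adjoint A y) * (norm y * K)"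
      by (simp add: ac_simps)
    then show "norm (adjoint A y) \<le> norm y * K"
      using K(2) by (cases "adjoint A y = 0") auto
  qed
qed

lemma
  fixes f :: "'a::{real_inner, complete_space} \<Rightarrow> real"
  assumes "continuously_differentiable f"
  shows has_derivative_gradient: "(f has_derivative (\<lambda>h. h \<bullet> gradient f x)) (at x)"
    and continuous_on_gradient: "continuous_on UNIV (gradient f)"
proof -
  obtain f' :: "'a \<Rightarrow> 'a \<Rightarrow>\<^sub>L real"
    where f': "\<And>x. (f has_derivative blinfun_apply (f' x)) (at x)" "continuous_on UNIV f'"
    using assms unfolding continuously_differentiable_def by blast
  have repr: "blinfun_apply (f' x) h = h \<bullet> gradient f x" for x h
  proof -
    obtain z where z: "\<And>h. blinfun_apply (f' x) h = h \<bullet> z"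
      using riesz_representation[OF blinfun.bounded_linear_right] by blast
    have "GDERIV f x :> z"
      unfolding gderiv_def using f'(1)[of x] by (simp flip: z)
    \<comment> \<open>Uniqueness is what allows the definite description in \<open>gradient\<close>
      to be evaluated.\<close>
    moreover have "w = z" if "GDERIV f x :> w" for w
    proof -
      have "(\<lambda>h. h \<bullet> w) = blinfun_apply (f' x)"
        using has_derivative_unique that f'(1) unfolding gderiv_def by blast
      then show ?thesis
        using z vector_eq_ldot by metis
    qed
    ultimately have "gradient f x = z"
      unfolding gradient_def by (intro the_equality)
    with z show ?thesis by simp
  qed
  then have eq: "blinfun_apply (f' x) = (\<lambda>h. h \<bullet> gradient f x)" for x by auto
  show "(f has_derivative (\<lambda>h. h \<bullet> gradient f x)) (at x)"
    using f'(1)[of x] by (simp add: eq)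
  \<comment> \<open>The Riesz correspondence does not increase norms, so continuity of
    \<open>f'\<close> in operator norm passes to the gradient.\<close>
  have le: "norm (gradient f y - gradient f x) \<le> norm (f' y - f' x)" for x y
  proof -
    let ?d = "gradient f y - gradient f x"
    have "norm ?d * norm ?d = blinfun_apply (f' y - f' x) ?d"
      by (simp add: blinfun.diff_left repr inner_diff_right[symmetric] dot_square_norm power2_eq_square)
    also have "\<dots> \<le> norm (f' y - f' x) * norm ?d"
      using norm_blinfun[of "f' y - f' x" ?d] by simp
    finally show ?thesis by (cases "?d = 0") auto
  qed
  show "continuous_on UNIV (gradient f)"
    unfolding continuous_on_iff
  proof (intro ballI allI impI)
    fix x :: 'a and e :: real assume "e > 0"
    then obtain d where "d > 0" "\<And>y. dist y x < d \<Longrightarrow> dist (f' y) (f' x) < e"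
      using f'(2) unfolding continuous_on_iff by blast
    then show "\<exists>d>0. \<forall>y\<in>UNIV. dist y x < d \<longrightarrow> dist (gradient f y) (gradient f x) < e"
      unfolding dist_norm using le_less_trans[OF le] by blast
  qed
qed

section \<open>Convexity and saddle points\<close>

lemma convex_on_above_tangent_hyperplane:
  fixes f :: "'a::real_normed_vector \<Rightarrow> real"
  assumes convex: "convex_on UNIV f" and deriv: "(f has_derivative D) (at x)"
  shows "f x + D (y - x) \<le> f y"
proof -
  \<comment> \<open>Restriction to the line through \<open>x\<close> and \<open>y\<close> reduces
    the claim to the tangent inequality for a convex function of one real variable, taken at
    0.\<close>
  define h where "h s = f (x + s *\<^sub>R (y - x))" for s
  have "convex_on UNIV h"
  proof (intro convex_onI)
    fix t r s :: real assume "0 < t" "t < 1"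
    have "x + ((1 - t) *\<^sub>R r + t *\<^sub>R s) *\<^sub>R (y - x)
        = (1 - t) *\<^sub>R (x + r *\<^sub>R (y - x)) + t *\<^sub>R (x + s *\<^sub>R (y - x))"
      by (simp add: algebra_simps)
    then show "h ((1 - t) *\<^sub>R r + t *\<^sub>R s) \<le> (1 - t) * h r + t * h s"
      unfolding h_def using convex_onD[OF convex, of t] \<open>0 < t\<close> \<open>t < 1\<close> by simp
  qed simp
  moreover have "(h has_field_derivative D (y - x)) (at 0)"
  proof -
    have "((\<lambda>s. x + s *\<^sub>R (y - x)) has_derivative (\<lambda>s. s *\<^sub>R (y - x))) (at 0)"
      by (auto intro!: derivative_eq_intros)
    moreover have "(f has_derivative D) (at (x + 0 *\<^sub>R (y - x)))"
      using deriv by simp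
    ultimately have "(h has_derivative (\<lambda>s. D (s *\<^sub>R (y - x)))) (at 0)"
      unfolding h_def by (rule has_derivative_compose)
    then show ?thesis
      unfolding has_field_derivative_def
      by (simp add: linear_cmul[OF has_derivative_linear[OF deriv]] mult_commute_abs)
  qed
  ultimately have "D (y - x) * (1 - 0) \<le> h 1 - h 0"
    by (intro convex_on_imp_above_tangent[where A = UNIV]) auto
  then show ?thesis by (simp add: h_def)
qed

lemma saddle_pointsD:
  assumes "(xs, ls) \<in> saddle_points f A b"
  shows "A xs = b" and "f xs \<le> f z + ls \<bullet> (A z - b)"
proof -
  have *: "lagrangian f A b xs l' \<le> lagrangian f A b xs ls"
    "lagrangian f A b xs ls \<le> lagrangian f A b z ls" for l' z
    using assms unfolding saddle_points_def by auto
  \<comment> \<open>Moving the multiplier in the direction of the residual would increase the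
    Lagrangian unless the residual vanishes.\<close>
  have "(A xs - b) \<bullet> (A xs - b) \<le> 0"
    using *(1)[of "ls + (A xs - b)"] by (simp add: lagrangian_def inner_add_left)
  then show b: "A xs = b"
    by (metis eq_iff_diff_eq_0 inner_eq_zero_iff inner_ge_zero order_antisym)
  show "f xs \<le> f z + ls \<bullet> (A z - b)"
    using *(2)[of z] b by (simp add: lagrangian_def)
qed

section \<open>Calculus along trajectories\<close>

lemma AE_lebesgue_eq_continuous_on:
  fixes g h :: "'a::euclidean_space \<Rightarrow> 'b::real_normed_vector"
  assumes "open S" and "continuous_on S g" "continuous_on S h"
    and "AE t in lebesgue. t \<in> S \<longrightarrow> g t = h t" and "t \<in> S"
  shows "g t = h t"
proof (rule ccontr)
  assume "g t \<noteq> h t"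
  \<comment> \<open>The points of disagreement in \<open>S\<close> form an open set; being
    negligible, it must be empty.\<close>
  define U where "U = S \<inter> (\<lambda>t. g t - h t) -` (- {0})"
  have "open U"
    unfolding U_def
    by (rule continuous_open_preimage) (auto intro!: continuous_intros assms)
  moreover have "t \<in> U"
    using \<open>g t \<noteq> h t\<close> \<open>t \<in> S\<close> by (auto simp: U_def)
  moreover obtain N where "negligible N" "{t. \<not> (t \<in> S \<longrightarrow> g t = h t)} \<subseteq> N"
    using assms(4) unfolding eventually_ae_filter_negligible by blast
  moreover have "U \<subseteq> {t. \<not> (t \<in> S \<longrightarrow> g t = h t)}"
    by (auto simp: U_def)
  ultimately show False
    using open_not_negligible negligible_subset by blast
qed

text \<open>At interior times the one-sided derivatives are two-sided. Everything below is therefore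
  stated for \<open>t > t0\<close>, which suffices for asymptotics.\<close>

lemma C2_on_ray_interior:
  assumes "C2_on_ray t0 u" and "t > t0"
  shows "(u has_vector_derivative ray_deriv t0 u t) (at t)"
    and "(ray_deriv t0 u has_vector_derivative ray_deriv t0 (ray_deriv t0 u) t) (at t)"
proof -
  have at: "at t within {t0..} = at t"
    using assms(2) by (intro at_within_interior) simp
  have "(v has_vector_derivative ray_deriv t0 v t) (at t)" if "v differentiable_on {t0..}" for v :: "real \<Rightarrow> 'a"
  proof -
    have "v differentiable (at t within {t0..})"
      using that assms(2) unfolding differentiable_on_def by simp
    then show ?thesis
      using vector_derivative_works unfolding ray_deriv_def at by blast
  qed
  then show "(u has_vector_derivative ray_deriv t0 u t) (at t)"
    and "(ray_deriv t0 u has_vector_derivative ray_deriv t0 (ray_deriv t0 u) t) (at t)"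
    using assms(1) unfolding C2_on_ray_def by blast+
qed

lemma half_norm_square_derivative:
  fixes u :: "real \<Rightarrow> 'a::real_inner"
  assumes "(u has_vector_derivative u') (at t)"
  shows "((\<lambda>t. (u t \<bullet> u t) / 2) has_real_derivative u t \<bullet> u') (at t)"
proof -
  have "((\<lambda>t. (u t \<bullet> u t) / 2) has_derivative (\<lambda>h. (u t \<bullet> (h *\<^sub>R u') + (h *\<^sub>R u') \<bullet> u t) / 2)) (at t)"
    using assms unfolding has_vector_derivative_def
    by (auto intro!: derivative_eq_intros)
  then show ?thesis
    unfolding has_field_derivative_def
    by (rule has_derivative_eq_rhs) (simp add: fun_eq_iff inner_commute[of u'])
qed

(* Gronwall-type bound; the shift by 1 keeps the square root differentiable where E vanishes. *)
lemma sqrt_growth_bound: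
  fixes E E' k :: "real \<Rightarrow> real"
  assumes "a \<le> T" and nonneg: "\<And>t. t \<in> {a..T} \<Longrightarrow> 0 \<le> E t"
    and deriv: "\<And>t. t \<in> {a..T} \<Longrightarrow> (E has_real_derivative E' t) (at t)"
    and growth: "\<And>t. t \<in> {a..T} \<Longrightarrow> E' t \<le> k t * sqrt (2 * E t)"
    and k: "continuous_on {a..T} k" "\<And>t. t \<in> {a..T} \<Longrightarrow> 0 \<le> k t"
  shows "sqrt (2 * E T + 1) \<le> sqrt (2 * E a + 1) + integral {a..T} k"
proof -
  \<comment> \<open>\<open>H\<close> is nonincreasing: after division by the shifted square root,
    the growth hypothesis bounds the derivative of the root by \<open>k t\<close>.\<close>
  define H where "H t = sqrt (2 * E t + 1) - integral {a..t} k" for t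
  have W: "((\<lambda>t. sqrt (2 * E t + 1)) has_real_derivative E' t / sqrt (2 * E t + 1)) (at t)"
    if "t \<in> {a..T}" for t
    using nonneg[OF that]
    by (auto intro!: derivative_eq_intros deriv that simp: field_simps)
  have K: "((\<lambda>u. integral {a..u} k) has_real_derivative k t) (at t within {a..T})"
    if "t \<in> {a..T}" for t
    by (rule integral_has_real_derivative[OF k(1) that])
  have "H T \<le> H a"
  proof (rule DERIV_nonpos_imp_decreasing_open[OF \<open>a \<le> T\<close>])
    fix t assume t: "a < t" "t < T"
    then have mem: "t \<in> {a..T}" by simp
    have "at t within {a..T} = at t"
      using t by (intro at_within_interior) simp
    then have "(H has_real_derivative E' t / sqrt (2 * E t + 1) - k t) (at t)"
      unfolding H_def using W[OF mem] K[OF mem] by (intro DERIV_diff) auto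
    moreover have "E' t \<le> k t * sqrt (2 * E t + 1)"
      using growth[OF mem] by (rule order_trans) (simp add: k(2)[OF mem] mult_left_mono)
    then have "E' t / sqrt (2 * E t + 1) - k t \<le> 0"
      using nonneg[OF mem] by (simp add: divide_le_eq)
    ultimately show "\<exists>y. (H has_real_derivative y) (at t) \<and> y \<le> 0" by blast
  next
    have "continuous_on {a..T} (\<lambda>t. sqrt (2 * E t + 1))"
      using W by (intro continuous_at_imp_continuous_on ballI DERIV_isCont) blast
    moreover have "continuous_on {a..T} (\<lambda>u. integral {a..u} k)"
      using K DERIV_continuous by (fastforce simp: continuous_on_eq_continuous_within)
    ultimately show "continuous_on {a..T} H"
      unfolding H_def by (rule continuous_on_diff)
  qed
  then show ?thesis by (simp add: H_def)
qed

section \<open>The energy estimate\<close>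

text \<open>The setting is classical: the equations hold at every \<open>t > t0\<close>,
  \<open>e\<close> is a continuous perturbation, and \<open>C\<close> bounds its weighted integrals
  uniformly. \<open>g\<close> and \<open>B\<close> stand for the gradient and the adjoint,
  \<open>\<theta>\<close> for \<open>1 / \<delta>\<close>.\<close>

locale primal_dual_trajectory =
  fixes f :: "'a::real_inner \<Rightarrow> real" and g :: "'a \<Rightarrow> 'a"
    and A :: "'a \<Rightarrow> 'b::real_inner" and B :: "'b \<Rightarrow> 'a" and b :: 'b
    and t0 \<alpha> \<delta> \<theta> \<sigma> \<mu> C :: real
    and e x x1 x2 :: "real \<Rightarrow> 'a" and l l1 l2 :: "real \<Rightarrow> 'b"
    and xs :: 'a and ls :: 'b
  assumes f_deriv: "\<And>z. (f has_derivative (\<lambda>h. h \<bullet> g z)) (at z)"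
    and f_tangent: "\<And>y z. f z + (y - z) \<bullet> g z \<le> f y"
    and A: "bounded_linear A" and adj: "\<And>z y. A z \<bullet> y = z \<bullet> B y"
    and saddle: "A xs = b" "\<And>z. f xs \<le> f z + ls \<bullet> (A z - b)"
    and params: "t0 > 0" "\<delta> > 0" "\<sigma> \<ge> 0" "\<mu> > 0" "\<delta> * \<theta> = 1" "\<theta> < \<alpha> - 1"
    and x_deriv: "\<And>t. t > t0 \<Longrightarrow> (x has_vector_derivative x1 t) (at t)"
    and x1_deriv: "\<And>t. t > t0 \<Longrightarrow> (x1 has_vector_derivative x2 t) (at t)"
    and l_deriv: "\<And>t. t > t0 \<Longrightarrow> (l has_vector_derivative l1 t) (at t)"
    and l1_deriv: "\<And>t. t > t0 \<Longrightarrow> (l1 has_vector_derivative l2 t) (at t)"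
    and primal: "\<And>t. t > t0 \<Longrightarrow> x2 t + (\<alpha> / t) *\<^sub>R x1 t =
        - ((\<mu> * t powr (\<theta> - 2)) *\<^sub>R (g (x t) + B (l t + (\<delta> * t) *\<^sub>R l1 t)
             + \<sigma> *\<^sub>R B (A (x t) - b))) + e t"
    and dual: "\<And>t. t > t0 \<Longrightarrow> l2 t + (\<alpha> / t) *\<^sub>R l1 t =
        (\<mu> * t powr (\<theta> - 2)) *\<^sub>R (A (x t + (\<delta> * t) *\<^sub>R x1 t) - b)"
    and e_cont: "continuous_on {t0<..} e"
    and e_bound: "\<And>a t. t0 < a \<Longrightarrow> a \<le> t \<Longrightarrow> integral {a..t} (\<lambda>s. s * norm (e s)) \<le> C"
begin

sublocale A: bounded_linear A by (rule A)

definition gap :: "'a \<Rightarrow> real" where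
  "gap z = f z - f xs + ls \<bullet> (A z - b) + \<sigma> * (((A z - b) \<bullet> (A z - b)) / 2)"

definition gap_grad :: "'a \<Rightarrow> 'a" where
  "gap_grad z = g z + B ls + \<sigma> *\<^sub>R B (A z - b)"

text \<open>This is what remains of the damping: \<open>\<delta> * t\<close> times
  \<open>\<alpha> / t\<close>, less the coefficient \<open>1 + \<delta>\<close> of the velocity in
  the derivative of \<open>u\<close> or \<open>v\<close>.\<close>

definition \<eta> :: real where "\<eta> = \<delta> * \<alpha> - \<delta> - 1"
definition u :: "real \<Rightarrow> 'a" where "u t = x t - xs + (\<delta> * t) *\<^sub>R x1 t"
definition v :: "real \<Rightarrow> 'b" where "v t = l t - ls + (\<delta> * t) *\<^sub>R l1 t"

definition energy :: "real \<Rightarrow> real" where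
  "energy t = \<delta>\<^sup>2 * \<mu> * (t powr \<theta> * gap (x t)) + (u t \<bullet> u t) / 2 + (v t \<bullet> v t) / 2
     + \<eta> * (((x t - xs) \<bullet> (x t - xs)) / 2) + \<eta> * (((l t - ls) \<bullet> (l t - ls)) / 2)"

lemma \<eta>_pos: "\<eta> > 0"
proof -
  have "\<delta> * \<theta> < \<delta> * (\<alpha> - 1)"
    using params by (intro mult_strict_left_mono) auto
  then show ?thesis
    using params by (simp add: \<eta>_def algebra_simps)
qed

lemma gap_nonneg: "0 \<le> gap z"
  using saddle(2)[of z] params unfolding gap_def by simp

text \<open>The tangent inequality for \<open>f\<close> is combined with the quadratic term, which
  appears in full on the right but halved in \<open>gap\<close>. In the energy estimate this absorbs
  the growth of \<open>t powr \<theta>\<close>.\<close>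

lemma gap_le: "gap z \<le> (z - xs) \<bullet> gap_grad z"
proof -
  have "(z - xs) \<bullet> B y = (A z - b) \<bullet> y" for y
    by (simp add: adj[symmetric] A.diff saddle(1))
  then have "(z - xs) \<bullet> gap_grad z
      = (z - xs) \<bullet> g z + ls \<bullet> (A z - b) + \<sigma> * ((A z - b) \<bullet> (A z - b))"
    unfolding gap_grad_def by (simp add: inner_add_right inner_commute[of ls])
  moreover have "f z - f xs \<le> (z - xs) \<bullet> g z"
    using f_tangent[of z xs] by (simp add: inner_diff_left)
  moreover have "\<sigma> * (((A z - b) \<bullet> (A z - b)) / 2) \<le> \<sigma> * ((A z - b) \<bullet> (A z - b))"
    using params by (intro mult_left_mono) auto
  ultimately show ?thesis unfolding gap_def by simp
qed

section \<open>The derivative of the energy at a fixed time\<close>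

context
  fixes t assumes t: "t > t0"
begin

lemma t_pos: "t > 0"
  using t params by simp

lemma residual_deriv: "((\<lambda>t. A (x t) - b) has_vector_derivative A (x1 t)) (at t)"
  using A.has_vector_derivative[OF x_deriv[OF t]]
  by (auto intro!: derivative_eq_intros)

lemma gap_deriv: "((\<lambda>t. gap (x t)) has_real_derivative x1 t \<bullet> gap_grad (x t)) (at t)"
proof -
  have "((\<lambda>t. f (x t)) has_derivative (\<lambda>h. (h *\<^sub>R x1 t) \<bullet> g (x t))) (at t)"
    using x_deriv[OF t] f_deriv unfolding has_vector_derivative_def
    by (rule has_derivative_compose)
  then have 1: "((\<lambda>t. f (x t)) has_real_derivative x1 t \<bullet> g (x t)) (at t)"
    unfolding has_field_derivative_def
    by (rule has_derivative_eq_rhs) (simp add: fun_eq_iff)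
  have 2: "((\<lambda>t. ls \<bullet> (A (x t) - b)) has_real_derivative ls \<bullet> A (x1 t)) (at t)"
    using bounded_linear.has_vector_derivative[OF bounded_linear_inner_right residual_deriv]
    by (simp add: has_real_derivative_iff_has_vector_derivative)
  have "((\<lambda>t. gap (x t)) has_real_derivative
      x1 t \<bullet> g (x t) - 0 + ls \<bullet> A (x1 t) + \<sigma> * ((A (x t) - b) \<bullet> A (x1 t))) (at t)"
    unfolding gap_def
    by (intro DERIV_add DERIV_diff DERIV_const DERIV_cmult 1 2
        half_norm_square_derivative residual_deriv)
  then show ?thesis
    by (simp add: gap_grad_def inner_add_right adj[symmetric] inner_commute[of _ "A (x1 t)"])
qed

text \<open>The product of \<open>\<delta> * t\<close> with the scaling of the system: the common
  factor of the forces in the derivatives of \<open>u\<close> and \<open>v\<close>.\<close>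

definition "w = \<mu> * \<delta> * t powr (\<theta> - 1)"

lemma w_eq: "\<delta> * t * (\<mu> * t powr (\<theta> - 2)) = w"
proof -
  have "t powr (\<theta> - 1) = t powr (\<theta> - 2) * t"
    using t_pos powr_add[of t "\<theta> - 2" 1] by simp
  then show ?thesis by (simp add: w_def)
qed

lemma u_deriv: "(u has_vector_derivative
    - \<eta> *\<^sub>R x1 t - w *\<^sub>R (gap_grad (x t) + B (v t)) + (\<delta> * t) *\<^sub>R e t) (at t)"
proof -
  have B_add: "B (y + z) = B y + B z" for y z
    by (subst vector_eq_ldot[symmetric]) (simp add: adj[symmetric] inner_simps)
  have split: "B (l t + (\<delta> * t) *\<^sub>R l1 t) = B ls + B (v t)"
    by (simp add: B_add[symmetric] v_def)
  have x2: "x2 t = - (\<alpha> / t) *\<^sub>R x1 t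
      - (\<mu> * t powr (\<theta> - 2)) *\<^sub>R (gap_grad (x t) + B (v t)) + e t"
    using primal[OF t] by (simp add: split gap_grad_def algebra_simps eq_diff_eq)
  have "(u has_vector_derivative x1 t + ((\<delta> * t) *\<^sub>R x2 t + \<delta> *\<^sub>R x1 t)) (at t)"
    unfolding u_def
    by (auto intro!: derivative_eq_intros x_deriv[OF t] x1_deriv[OF t])
  moreover have "x1 t + ((\<delta> * t) *\<^sub>R x2 t + \<delta> *\<^sub>R x1 t)
      = - \<eta> *\<^sub>R x1 t - w *\<^sub>R (gap_grad (x t) + B (v t)) + (\<delta> * t) *\<^sub>R e t"
    using t_pos unfolding x2 \<eta>_def w_eq[symmetric] by (simp add: algebra_simps)
  ultimately show ?thesis by simp
qed

lemma v_deriv: "(v has_vector_derivative - \<eta> *\<^sub>R l1 t + w *\<^sub>R A (u t)) (at t)"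
proof -
  have Au: "A (u t) = A (x t + (\<delta> * t) *\<^sub>R x1 t) - b"
    unfolding u_def by (simp add: A.add A.diff saddle(1))
  have l2: "l2 t = - (\<alpha> / t) *\<^sub>R l1 t + (\<mu> * t powr (\<theta> - 2)) *\<^sub>R A (u t)"
    using dual[OF t] unfolding Au by (simp add: algebra_simps eq_diff_eq)
  have "(v has_vector_derivative l1 t + ((\<delta> * t) *\<^sub>R l2 t + \<delta> *\<^sub>R l1 t)) (at t)"
    unfolding v_def
    by (auto intro!: derivative_eq_intros l_deriv[OF t] l1_deriv[OF t])
  moreover have "l1 t + ((\<delta> * t) *\<^sub>R l2 t + \<delta> *\<^sub>R l1 t) = - \<eta> *\<^sub>R l1 t + w *\<^sub>R A (u t)"
    using t_pos unfolding l2 \<eta>_def w_eq[symmetric] by (simp add: algebra_simps)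
  ultimately show ?thesis by simp
qed

text \<open>Three groups of terms cancel: the coupling of \<open>u\<close> and \<open>v\<close>, the
  distance terms weighted by \<open>\<eta>\<close>, and the products of \<open>x1\<close> with
  \<open>gap_grad\<close>. Of the rest, only the perturbation can be positive.\<close>

lemma energy_deriv:
  "\<exists>E'. (energy has_real_derivative E') (at t) \<and> E' \<le> \<delta> * (t * norm (e t)) * sqrt (2 * energy t)"
proof -
  let ?D = "gap_grad (x t)" and ?p = "x t - xs" and ?q = "l t - ls"
  define u' where "u' = - \<eta> *\<^sub>R x1 t - w *\<^sub>R (?D + B (v t)) + (\<delta> * t) *\<^sub>R e t"
  define v' where "v' = - \<eta> *\<^sub>R l1 t + w *\<^sub>R A (u t)"
  define E' where "E' = \<delta>\<^sup>2 * \<mu> * (\<theta> * t powr (\<theta> - 1) * gap (x t) + (x1 t \<bullet> ?D) * t powr \<theta>)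
      + u t \<bullet> u' + v t \<bullet> v' + \<eta> * (?p \<bullet> x1 t) + \<eta> * (?q \<bullet> l1 t)"
  have pq: "((\<lambda>t. x t - xs) has_vector_derivative x1 t) (at t)"
    "((\<lambda>t. l t - ls) has_vector_derivative l1 t) (at t)"
    by (auto intro!: derivative_eq_intros x_deriv[OF t] l_deriv[OF t])
  have "(energy has_real_derivative E') (at t)"
    unfolding energy_def E'_def
    by (intro DERIV_add DERIV_cmult DERIV_mult has_real_derivative_powr t_pos gap_deriv
        half_norm_square_derivative pq u_deriv[folded u'_def] v_deriv[folded v'_def])
  moreover have "E' \<le> \<delta> * (t * norm (e t)) * sqrt (2 * energy t)"
  proof -
    \<comment> \<open>The relation \<open>\<delta> * \<theta> = 1\<close> gives the gap the same
      weight \<open>w\<close> as the gradient term in \<open>uu\<close>, so that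
      \<open>gap_le\<close> applies to their difference.\<close>
    have "\<delta>\<^sup>2 * \<mu> * (\<theta> * t powr (\<theta> - 1)) = (\<delta> * \<theta>) * w"
      by (simp add: w_def power2_eq_square)
    then have c1: "\<delta>\<^sup>2 * \<mu> * (\<theta> * t powr (\<theta> - 1)) = w"
      using params by simp
    have "t powr \<theta> = t powr (\<theta> - 1) * t"
      using t_pos powr_add[of t "\<theta> - 1" 1] by simp
    then have c2: "\<delta>\<^sup>2 * \<mu> * t powr \<theta> = \<delta> * t * w"
      by (simp add: w_def power2_eq_square)
    have c: "\<delta>\<^sup>2 * \<mu> * (\<theta> * t powr (\<theta> - 1) * gap (x t) + (x1 t \<bullet> ?D) * t powr \<theta>)
        = w * gap (x t) + \<delta> * t * w * (x1 t \<bullet> ?D)"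
    proof -
      have "\<delta>\<^sup>2 * \<mu> * (\<theta> * t powr (\<theta> - 1) * gap (x t) + (x1 t \<bullet> ?D) * t powr \<theta>)
          = (\<delta>\<^sup>2 * \<mu> * (\<theta> * t powr (\<theta> - 1))) * gap (x t) + (\<delta>\<^sup>2 * \<mu> * t powr \<theta>) * (x1 t \<bullet> ?D)"
        by (simp add: algebra_simps)
      then show ?thesis unfolding c1 c2 .
    qed
    \<comment> \<open>The coupling is skew: this quantity enters \<open>uu\<close> with factor
      \<open>- w\<close> and \<open>vv\<close> with factor \<open>w\<close>.\<close>
    have coupling: "v t \<bullet> A (u t) = u t \<bullet> B (v t)"
      by (simp add: adj[symmetric] inner_commute)
    have uu: "u t \<bullet> u' = - \<eta> * (?p \<bullet> x1 t) - \<eta> * \<delta> * t * (x1 t \<bullet> x1 t)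
        - w * (?p \<bullet> ?D) - \<delta> * t * w * (x1 t \<bullet> ?D) - w * (u t \<bullet> B (v t)) + \<delta> * t * (u t \<bullet> e t)"
    proof -
      have 1: "u t \<bullet> x1 t = ?p \<bullet> x1 t + \<delta> * t * (x1 t \<bullet> x1 t)"
        and 2: "u t \<bullet> ?D = ?p \<bullet> ?D + \<delta> * t * (x1 t \<bullet> ?D)"
        unfolding u_def by (simp_all add: inner_add_left)
      have "u t \<bullet> u' = - \<eta> * (u t \<bullet> x1 t) - w * (u t \<bullet> ?D + u t \<bullet> B (v t)) + \<delta> * t * (u t \<bullet> e t)"
        unfolding u'_def by (simp add: inner_add_right inner_diff_right)
      then show ?thesis
        unfolding 1 2 by (simp add: algebra_simps)
    qed
    have vv: "v t \<bullet> v' = - \<eta> * (?q \<bullet> l1 t) - \<eta> * \<delta> * t * (l1 t \<bullet> l1 t) + w * (u t \<bullet> B (v t))"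
    proof -
      have 1: "v t \<bullet> l1 t = ?q \<bullet> l1 t + \<delta> * t * (l1 t \<bullet> l1 t)"
        unfolding v_def by (simp add: inner_add_left)
      have "v t \<bullet> v' = - \<eta> * (v t \<bullet> l1 t) + w * (u t \<bullet> B (v t))"
        unfolding v'_def by (simp add: inner_add_right inner_diff_right coupling)
      then show ?thesis
        unfolding 1 by (simp add: algebra_simps)
    qed
    have "E' = w * (gap (x t) - ?p \<bullet> ?D)
        - \<eta> * \<delta> * t * (x1 t \<bullet> x1 t) - \<eta> * \<delta> * t * (l1 t \<bullet> l1 t) + \<delta> * t * (u t \<bullet> e t)"
      unfolding E'_def c uu vv by (simp add: algebra_simps)
    moreover have "w * (gap (x t) - ?p \<bullet> ?D) \<le> 0"
      using gap_le[of "x t"] params by (intro mult_nonneg_nonpos) (auto simp: w_def)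
    moreover have "0 \<le> \<eta> * \<delta> * t * (x1 t \<bullet> x1 t)" "0 \<le> \<eta> * \<delta> * t * (l1 t \<bullet> l1 t)"
      using \<eta>_pos params t_pos by simp_all
    ultimately have "E' \<le> \<delta> * t * (u t \<bullet> e t)" by linarith
    also have "\<dots> \<le> \<delta> * t * (norm (u t) * norm (e t))"
      using params t_pos norm_cauchy_schwarz by (intro mult_left_mono) auto
    also have "\<dots> \<le> \<delta> * t * (sqrt (2 * energy t) * norm (e t))"
    proof -
      have "0 \<le> \<delta>\<^sup>2 * \<mu> * (t powr \<theta> * gap (x t))" "0 \<le> (v t \<bullet> v t) / 2"
        "0 \<le> \<eta> * ((?p \<bullet> ?p) / 2)" "0 \<le> \<eta> * ((?q \<bullet> ?q) / 2)"
        using \<eta>_pos params gap_nonneg by simp_all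
      then have "(u t \<bullet> u t) / 2 \<le> energy t"
        unfolding energy_def by linarith
      then have "norm (u t) \<le> sqrt (2 * energy t)"
        by (simp add: norm_eq_sqrt_inner)
      then show ?thesis
        using params t_pos by (intro mult_left_mono mult_right_mono) auto
    qed
    finally show ?thesis by (simp add: ac_simps)
  qed
  ultimately show ?thesis by blast
qed

end

section \<open>Boundedness of the energy and decay\<close>

lemma energy_nonneg: "0 \<le> energy t"
  using \<eta>_pos params gap_nonneg[of "x t"] unfolding energy_def by simp

text \<open>The growth bound is started at some \<open>a > t0\<close> because differentiability of
  the energy is known only on the open half-line; \<open>C\<close> does not depend on the end time,
  hence neither does \<open>M\<close>.\<close>

lemma energy_bounded:
  assumes "t0 < a"
  obtains M where "\<And>t. a \<le> t \<Longrightarrow> energy t \<le> M"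
proof
  fix t assume "a \<le> t"
  obtain E' where E': "\<And>s. s > t0 \<Longrightarrow> (energy has_real_derivative E' s) (at s)"
    "\<And>s. s > t0 \<Longrightarrow> E' s \<le> \<delta> * (s * norm (e s)) * sqrt (2 * energy s)"
    using energy_deriv by metis
  have sub: "{a..t} \<subseteq> {t0<..}" using assms by auto
  have "sqrt (2 * energy t + 1) \<le> sqrt (2 * energy a + 1)
      + integral {a..t} (\<lambda>s. \<delta> * (s * norm (e s)))"
  proof (rule sqrt_growth_bound[OF \<open>a \<le> t\<close>])
    show "continuous_on {a..t} (\<lambda>s. \<delta> * (s * norm (e s)))"
      using continuous_on_subset[OF e_cont sub] by (intro continuous_intros)
  qed (use sub params in \<open>auto intro: energy_nonneg E'\<close>)
  also have "\<dots> \<le> sqrt (2 * energy a + 1) + \<delta> * C"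
    using e_bound[OF assms \<open>a \<le> t\<close>] params by simp
  finally have "(sqrt (2 * energy t + 1))\<^sup>2 \<le> (sqrt (2 * energy a + 1) + \<delta> * C)\<^sup>2"
    using energy_nonneg by (intro power_mono) auto
  then show "energy t \<le> (sqrt (2 * energy a + 1) + \<delta> * C)\<^sup>2"
    using energy_nonneg[of t] by simp
qed

(* Multiplied by t, the dual equation is an exact derivative, because t^theta differentiates to
   theta * t^(theta - 1) and delta * theta = 1. *)
lemma dual_first_integral:
  obtains c where
    "\<And>t. t > t0 \<Longrightarrow> t *\<^sub>R l1 t + (\<alpha> - 1) *\<^sub>R l t - (\<mu> * \<delta> * t powr \<theta>) *\<^sub>R (A (x t) - b) = c"
proof -
  let ?F = "\<lambda>t. t *\<^sub>R l1 t + (\<alpha> - 1) *\<^sub>R l t - (\<mu> * \<delta> * t powr \<theta>) *\<^sub>R (A (x t) - b)"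
  have "(?F has_vector_derivative 0) (at t)" if t: "t > t0" for t
  proof -
    have tp: "t > 0" using t params by simp
    have powr: "((\<lambda>t. \<mu> * \<delta> * t powr \<theta>) has_real_derivative \<mu> * \<delta> * (\<theta> * t powr (\<theta> - 1))) (at t)"
      by (intro DERIV_cmult has_real_derivative_powr tp)
    have l2: "l2 t = - (\<alpha> / t) *\<^sub>R l1 t
        + (\<mu> * t powr (\<theta> - 2)) *\<^sub>R ((A (x t) - b) + (\<delta> * t) *\<^sub>R A (x1 t))"
      using dual[OF t] by (simp add: A.add A.scaleR algebra_simps eq_diff_eq)
    \<comment> \<open>With these two identities \<open>t\<close> times the right side of the dual
      equation is the derivative of the residual weighted by
      \<open>\<mu> * \<delta> * t powr \<theta>\<close>.\<close>
    have c: "\<mu> * \<delta> * (\<theta> * t powr (\<theta> - 1)) = t * (\<mu> * t powr (\<theta> - 2))"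
      "\<mu> * \<delta> * t powr \<theta> = t * (\<mu> * t powr (\<theta> - 2)) * (\<delta> * t)"
    proof -
      have "t powr (\<theta> - 1) = t powr (\<theta> - 2) * t" "t powr \<theta> = t powr (\<theta> - 2) * t * t"
        using tp powr_add[of t "\<theta> - 2" 1] powr_add[of t "\<theta> - 1" 1] by simp_all
      moreover have "\<mu> * \<delta> * (\<theta> * s) = \<mu> * s" for s
      proof -
        have "\<mu> * \<delta> * (\<theta> * s) = \<mu> * (\<delta> * \<theta>) * s" by simp
        then show ?thesis using params by simp
      qed
      ultimately show "\<mu> * \<delta> * (\<theta> * t powr (\<theta> - 1)) = t * (\<mu> * t powr (\<theta> - 2))"
        "\<mu> * \<delta> * t powr \<theta> = t * (\<mu> * t powr (\<theta> - 2)) * (\<delta> * t)" by simp_all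
    qed
    have "(?F has_vector_derivative (t *\<^sub>R l2 t + 1 *\<^sub>R l1 t) + (\<alpha> - 1) *\<^sub>R l1 t
        - ((\<mu> * \<delta> * t powr \<theta>) *\<^sub>R A (x1 t)
           + (\<mu> * \<delta> * (\<theta> * t powr (\<theta> - 1))) *\<^sub>R (A (x t) - b))) (at t)"
      by (intro has_vector_derivative_diff has_vector_derivative_add
          has_vector_derivative_scaleR DERIV_ident l1_deriv t powr residual_deriv
          bounded_linear.has_vector_derivative[OF bounded_linear_scaleR_right] l_deriv)
    moreover have "(t *\<^sub>R l2 t + 1 *\<^sub>R l1 t) + (\<alpha> - 1) *\<^sub>R l1 t
        - ((\<mu> * \<delta> * t powr \<theta>) *\<^sub>R A (x1 t)
           + (\<mu> * \<delta> * (\<theta> * t powr (\<theta> - 1))) *\<^sub>R (A (x t) - b)) = 0"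
      using tp unfolding c l2 by (simp add: algebra_simps)
    ultimately show ?thesis by metis
  qed
  then have "(?F has_vector_derivative 0) (at t within {t0<..})" if "t \<in> {t0<..}" for t
    using that has_vector_derivative_at_within by blast
  from has_vector_derivative_zero_constant[OF convex_real_interval(3) this]
  show ?thesis using that by (metis greaterThan_iff)
qed

text \<open>The residual is estimated first, through the first integral; the objective follows by
  solving the definition of \<open>gap\<close> for \<open>f\<close>.\<close>

theorem decay_rates:
  assumes a: "t0 < a"
  obtains K where "\<And>t. a \<le> t \<Longrightarrow> t powr \<theta> * norm (A (x t) - b) \<le> K"
    and "\<And>t. a \<le> t \<Longrightarrow> t powr \<theta> * \<bar>f (x t) - f xs\<bar> \<le> K"
proof -
  obtain M where M: "\<And>t. a \<le> t \<Longrightarrow> energy t \<le> M"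
    using energy_bounded[OF a] by blast
  have comps: "\<delta>\<^sup>2 * \<mu> * (t powr \<theta> * gap (x t)) \<le> M" "(norm (v t))\<^sup>2 \<le> 2 * M"
    "(norm (l t - ls))\<^sup>2 \<le> 2 * M / \<eta>" if "a \<le> t" for t
  proof -
    have "0 \<le> \<delta>\<^sup>2 * \<mu> * (t powr \<theta> * gap (x t))" "0 \<le> (u t \<bullet> u t) / 2" "0 \<le> (v t \<bullet> v t) / 2"
      "0 \<le> \<eta> * (((x t - xs) \<bullet> (x t - xs)) / 2)" "0 \<le> \<eta> * (((l t - ls) \<bullet> (l t - ls)) / 2)"
      using \<eta>_pos params gap_nonneg by simp_all
    with M[OF that] have "\<delta>\<^sup>2 * \<mu> * (t powr \<theta> * gap (x t)) \<le> M" "(v t \<bullet> v t) / 2 \<le> M"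
      "\<eta> * (((l t - ls) \<bullet> (l t - ls)) / 2) \<le> M"
      unfolding energy_def by linarith+
    then show "\<delta>\<^sup>2 * \<mu> * (t powr \<theta> * gap (x t)) \<le> M" "(norm (v t))\<^sup>2 \<le> 2 * M"
      "(norm (l t - ls))\<^sup>2 \<le> 2 * M / \<eta>"
      using \<eta>_pos by (simp_all add: dot_square_norm field_simps)
  qed
  define Q where "Q = sqrt (2 * M / \<eta>)"
  define V where "V = sqrt (2 * M)"
  have Q: "norm (l t - ls) \<le> Q" and V: "norm (v t) \<le> V" if "a \<le> t" for t
    using comps[OF that] unfolding Q_def V_def by (auto intro: real_le_rsqrt)
  have \<theta>: "\<theta> > 0"
    using params by (metis zero_less_mult_pos zero_less_one)
  then have \<alpha>: "\<alpha> - 1 > 0"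
    using params by simp
  obtain c where c:
    "\<And>t. t > t0 \<Longrightarrow> t *\<^sub>R l1 t + (\<alpha> - 1) *\<^sub>R l t - (\<mu> * \<delta> * t powr \<theta>) *\<^sub>R (A (x t) - b) = c"
    using dual_first_integral by blast
  define R where "R = ((V + Q) / \<delta> + (\<alpha> - 1) * (Q + norm ls) + norm c) / (\<mu> * \<delta>)"
  have R: "t powr \<theta> * norm (A (x t) - b) \<le> R" if "a \<le> t" for t
  proof -
    have t: "t > t0" and tp: "t > 0" using that a params by auto
    have "norm ((\<delta> * t) *\<^sub>R l1 t) \<le> V + Q"
    proof -
      \<comment> \<open>The energy controls \<open>v\<close> and \<open>l - ls\<close> separately,
        hence also the velocity term that is their difference.\<close>
      have "(\<delta> * t) *\<^sub>R l1 t = v t - (l t - ls)" by (simp add: v_def)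
      then show ?thesis using norm_triangle_ineq4[of "v t" "l t - ls"] Q[OF that] V[OF that] by simp
    qed
    then have 1: "norm (t *\<^sub>R l1 t) \<le> (V + Q) / \<delta>"
      using params tp by (simp add: field_simps)
    have "norm (l t) \<le> Q + norm ls"
      using norm_triangle_sub[of "l t" ls] Q[OF that] by simp
    then have 2: "norm ((\<alpha> - 1) *\<^sub>R l t) \<le> (\<alpha> - 1) * (Q + norm ls)"
      using \<alpha> by simp
    have "(\<mu> * \<delta> * t powr \<theta>) *\<^sub>R (A (x t) - b) = t *\<^sub>R l1 t + (\<alpha> - 1) *\<^sub>R l t - c"
      by (simp flip: c[OF t])
    then have "norm ((\<mu> * \<delta> * t powr \<theta>) *\<^sub>R (A (x t) - b))
        \<le> norm (t *\<^sub>R l1 t) + norm ((\<alpha> - 1) *\<^sub>R l t) + norm c"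
      using norm_triangle_ineq4[of "t *\<^sub>R l1 t + (\<alpha> - 1) *\<^sub>R l t" c]
        norm_triangle_ineq[of "t *\<^sub>R l1 t" "(\<alpha> - 1) *\<^sub>R l t"] by simp
    also have "\<dots> \<le> (V + Q) / \<delta> + (\<alpha> - 1) * (Q + norm ls) + norm c"
      using 1 2 by simp
    finally have "\<mu> * \<delta> * (t powr \<theta> * norm (A (x t) - b))
        \<le> (V + Q) / \<delta> + (\<alpha> - 1) * (Q + norm ls) + norm c"
      using params by (simp add: mult.assoc)
    then show ?thesis
      using params by (simp add: R_def pos_le_divide_eq mult.commute)
  qed
  \<comment> \<open>In the quadratic penalty one residual factor absorbs
    \<open>t powr \<theta>\<close>; the other only has to be bounded, by its estimate at the
    smallest time \<open>a\<close>.\<close>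
  define S where "S = M / (\<delta>\<^sup>2 * \<mu>) + norm ls * R + \<sigma> / 2 * (R * (R / a powr \<theta>))"
  have S: "t powr \<theta> * \<bar>f (x t) - f xs\<bar> \<le> S" if "a \<le> t" for t
  proof -
    let ?y = "A (x t) - b" and ?p = "t powr \<theta>"
    have p: "0 < a powr \<theta>" "a powr \<theta> \<le> ?p"
      using that a params \<theta> by (auto intro: powr_mono2)
    have "R \<ge> 0"
      by (rule order_trans[OF _ R[OF that]]) simp
    have "norm ?y \<le> R / a powr \<theta>"
    proof -
      have "a powr \<theta> * norm ?y \<le> ?p * norm ?y"
        using p by (intro mult_right_mono) auto
      with R[OF that] p show ?thesis by (simp add: field_simps)
    qed
    have gap: "?p * gap (x t) \<le> M / (\<delta>\<^sup>2 * \<mu>)"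
      using comps(1)[OF that] params by (simp add: field_simps)
    have "\<bar>f (x t) - f xs\<bar> \<le> gap (x t) + norm ls * norm ?y + \<sigma> / 2 * (norm ?y * norm ?y)"
    proof -
      have "\<bar>ls \<bullet> ?y\<bar> \<le> norm ls * norm ?y" by (rule Cauchy_Schwarz_ineq2)
      moreover have "f (x t) - f xs = gap (x t) - ls \<bullet> ?y - \<sigma> / 2 * (norm ?y * norm ?y)"
        unfolding gap_def by (simp add: dot_square_norm power2_eq_square)
      moreover have "0 \<le> \<sigma> / 2 * (norm ?y * norm ?y)" using params by simp
      ultimately show ?thesis using gap_nonneg[of "x t"] by linarith
    qed
    then have "?p * \<bar>f (x t) - f xs\<bar>
        \<le> ?p * (gap (x t) + norm ls * norm ?y + \<sigma> / 2 * (norm ?y * norm ?y))"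
      by (rule mult_left_mono) simp
    also have "\<dots> = ?p * gap (x t) + norm ls * (?p * norm ?y) + \<sigma> / 2 * ((?p * norm ?y) * norm ?y)"
      by (simp add: algebra_simps)
    also have "\<dots> \<le> S"
      unfolding S_def using gap R[OF that] \<open>norm ?y \<le> R / a powr \<theta>\<close> \<open>R \<ge> 0\<close> params
      by (intro add_mono mult_left_mono mult_mono) auto
    finally show ?thesis .
  qed
  show ?thesis
    by (rule that[of "max R S"]) (use R S in \<open>auto simp: le_max_iff_disj\<close>)
qed

end

section \<open>The convergence rates\<close>

theorem theorem2p11:
  fixes f :: "'a::{real_inner, complete_space} \<Rightarrow> real"
    and A :: "'a \<Rightarrow> 'b::{real_inner, complete_space}"
    and b :: 'b
    and t0 \<alpha> \<delta> \<sigma> \<mu> :: real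
    and \<beta> :: "real \<Rightarrow> real"
    and \<epsilon> :: "real \<Rightarrow> 'a"
    and x :: "real \<Rightarrow> 'a"
    and l :: "real \<Rightarrow> 'b"
  assumes "bounded_linear A"
    and "convex_on UNIV f"
    and "continuously_differentiable f"
    and "saddle_points f A b \<noteq> {}"
    and "t0 > 0" and "\<alpha> > 0" and "\<delta> > 0" and "\<sigma> \<ge> 0" and "\<mu> > 0"
    and "2 \<le> 1 / \<delta>" and "1 / \<delta> < \<alpha> - 1"
    and "\<And>t. t \<ge> t0 \<Longrightarrow> \<beta> t = \<mu> * t powr (1 / \<delta> - 2)"
    and "set_integrable lebesgue {t0..} (\<lambda>t. t * norm (\<epsilon> t))"
    and "global_solution t0 \<alpha> \<delta> \<sigma> \<beta> f A b \<epsilon> x l"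
  shows "\<forall>(xs, ls) \<in> saddle_points f A b.
           (\<lambda>t. \<bar>f (x t) - f xs\<bar>) \<in> O(\<lambda>t. 1 / t powr (1 / \<delta>)) \<and>
           (\<lambda>t. norm (A (x t) - b)) \<in> O(\<lambda>t. 1 / t powr (1 / \<delta>))"
proof (clarify, intro conjI)
  fix xs ls assume saddle: "(xs, ls) \<in> saddle_points f A b"
  define \<theta> where "\<theta> = 1 / \<delta>"
  define x1 x2 l1 l2 where "x1 = ray_deriv t0 x" and "x2 = ray_deriv t0 x1"
    and "l1 = ray_deriv t0 l" and "l2 = ray_deriv t0 l1"
  note defs = x1_def x2_def l1_def l2_def
  have A: "bounded_linear A" and t0: "t0 > 0" by fact+
  have C2: "C2_on_ray t0 x" "C2_on_ray t0 l"
    and ae: "AE t in lebesgue. t \<ge> t0 \<longrightarrow>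
        x2 t + (\<alpha> / t) *\<^sub>R x1 t =
          - (\<beta> t *\<^sub>R (gradient f (x t) + adjoint A (l t + (\<delta> * t) *\<^sub>R l1 t)
                     + \<sigma> *\<^sub>R adjoint A (A (x t) - b))) + \<epsilon> t \<and>
        l2 t + (\<alpha> / t) *\<^sub>R l1 t = \<beta> t *\<^sub>R (A (x t + (\<delta> * t) *\<^sub>R x1 t) - b)"
    using \<open>global_solution t0 \<alpha> \<delta> \<sigma> \<beta> f A b \<epsilon> x l\<close>
    unfolding global_solution_def defs by blast+
  have derivs: "(x has_vector_derivative x1 t) (at t)" "(x1 has_vector_derivative x2 t) (at t)"
    "(l has_vector_derivative l1 t) (at t)" "(l1 has_vector_derivative l2 t) (at t)"
    if "t > t0" for t
    using C2[THEN C2_on_ray_interior(1), OF that] C2[THEN C2_on_ray_interior(2), OF that]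
    unfolding defs by auto
  have cont: "continuous_on {t0<..} x" "continuous_on {t0<..} x1" "continuous_on {t0<..} l"
    "continuous_on {t0<..} l1"
    using derivs
    by (auto intro!: continuous_at_imp_continuous_on has_vector_derivative_continuous)
  have cont2: "continuous_on {t0<..} x2" "continuous_on {t0<..} l2"
    using C2 unfolding C2_on_ray_def defs by (auto elim: continuous_on_subset)
  define F where "F t = (\<mu> * t powr (\<theta> - 2)) *\<^sub>R
      (gradient f (x t) + adjoint A (l t + (\<delta> * t) *\<^sub>R l1 t) + \<sigma> *\<^sub>R adjoint A (A (x t) - b))" for t
  \<comment> \<open>The continuous representative of \<open>\<epsilon>\<close> is defined as the
    defect of the primal equation, which then holds at all times by construction.\<close>
  define e where "e t = x2 t + (\<alpha> / t) *\<^sub>R x1 t + F t" for t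
  have cont_grad: "continuous_on {t0<..} (\<lambda>t. gradient f (x t))"
    by (rule continuous_on_compose2[OF continuous_on_gradient cont(1)]) (use assms in auto)
  have e_cont: "continuous_on {t0<..} e"
    unfolding e_def F_def using t0
    by (intro continuous_intros cont cont2 cont_grad
        bounded_linear.continuous_on[OF bounded_linear_adjoint[OF A]]
        bounded_linear.continuous_on[OF A]) auto
  have \<beta>: "\<beta> t = \<mu> * t powr (\<theta> - 2)" if "t > t0" for t
    using assms(12)[of t] that by (simp add: \<theta>_def)
  have dual: "l2 t + (\<alpha> / t) *\<^sub>R l1 t = (\<mu> * t powr (\<theta> - 2)) *\<^sub>R (A (x t + (\<delta> * t) *\<^sub>R x1 t) - b)"
    if "t > t0" for t
  proof (rule AE_lebesgue_eq_continuous_on[of "{t0<..}"])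
    show "continuous_on {t0<..} (\<lambda>t. l2 t + (\<alpha> / t) *\<^sub>R l1 t)"
      using t0 by (intro continuous_intros cont cont2) auto
    show "continuous_on {t0<..} (\<lambda>t. (\<mu> * t powr (\<theta> - 2)) *\<^sub>R (A (x t + (\<delta> * t) *\<^sub>R x1 t) - b))"
      using t0 by (intro continuous_intros cont bounded_linear.continuous_on[OF A]) auto
    show "AE t in lebesgue. t \<in> {t0<..} \<longrightarrow> l2 t + (\<alpha> / t) *\<^sub>R l1 t
        = (\<mu> * t powr (\<theta> - 2)) *\<^sub>R (A (x t + (\<delta> * t) *\<^sub>R x1 t) - b)"
      using ae by eventually_elim (simp add: \<beta>)
  qed (use that in auto)
  have "AE t in lebesgue. t > t0 \<longrightarrow> e t = \<epsilon> t"
    using ae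
  proof eventually_elim
    case (elim t)
    then show ?case by (auto simp: e_def F_def \<beta>)
  qed
  then obtain N where N: "negligible N" "\<And>t. t \<notin> N \<Longrightarrow> t > t0 \<Longrightarrow> e t = \<epsilon> t"
    unfolding eventually_ae_filter_negligible by blast
  define h where "h t = t * norm (\<epsilon> t)" for t
  have h: "h integrable_on {t0..}"
    using set_lebesgue_integral_eq_integral(1) assms(13) unfolding h_def by blast
  have bound: "integral {a..t} (\<lambda>s. s * norm (e s)) \<le> integral {t0..} h" if "t0 < a" "a \<le> t" for a t
  proof -
    \<comment> \<open>Since \<open>a > t0\<close>, the integrands differ on this interval only
      inside the negligible set \<open>N\<close>.\<close>
    have "integral {a..t} (\<lambda>s. s * norm (e s)) = integral {a..t} h"
      using N that by (intro integral_spike[OF N(1)]) (auto simp: h_def)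
    also have "\<dots> \<le> integral {t0..} h"
      using that t0 by (intro integral_subset_le integrable_on_subinterval[OF h] h)
        (auto simp: h_def)
    finally show ?thesis .
  qed
  interpret primal_dual_trajectory f "gradient f" A "adjoint A" b t0 \<alpha> \<delta> \<theta> \<sigma> \<mu>
    "integral {t0..} h" e x x1 x2 l l1 l2 xs ls
  proof (rule primal_dual_trajectory.intro)
    show "x2 t + (\<alpha> / t) *\<^sub>R x1 t = - ((\<mu> * t powr (\<theta> - 2)) *\<^sub>R
        (gradient f (x t) + adjoint A (l t + (\<delta> * t) *\<^sub>R l1 t) + \<sigma> *\<^sub>R adjoint A (A (x t) - b))) + e t"
      for t by (simp add: e_def F_def)
    show "f z + (y - z) \<bullet> gradient f z \<le> f y" for y z
      by (rule convex_on_above_tangent_hyperplane[OF assms(2) has_derivative_gradient[OF assms(3)]])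
    show "\<delta> * \<theta> = 1" "\<theta> < \<alpha> - 1"
      using assms by (simp_all add: \<theta>_def)
  qed (fact A assms(5,7-9) derivs dual bound e_cont saddle_pointsD[OF saddle] inner_adjoint[OF A]
      has_derivative_gradient[OF assms(3)])+
  \<comment> \<open>Any base time beyond \<open>t0\<close> would do; \<open>t0 + 1\<close> is a
    convenient one.\<close>
  obtain K where K: "\<And>t. t0 + 1 \<le> t \<Longrightarrow> t powr \<theta> * norm (A (x t) - b) \<le> K"
    "\<And>t. t0 + 1 \<le> t \<Longrightarrow> t powr \<theta> * \<bar>f (x t) - f xs\<bar> \<le> K"
    using decay_rates[of "t0 + 1"] by auto
  have bigo: "\<phi> \<in> O(\<lambda>t. 1 / t powr (1 / \<delta>))"
    if "\<And>t. t0 + 1 \<le> t \<Longrightarrow> t powr \<theta> * \<bar>\<phi> t\<bar> \<le> K" for \<phi> :: "real \<Rightarrow> real"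
  proof (rule bigoI[of _ K])
    show "eventually (\<lambda>t. norm (\<phi> t) \<le> K * norm (1 / t powr (1 / \<delta>))) at_top"
      using eventually_ge_at_top[of "t0 + 1"]
    proof eventually_elim
      case (elim t)
      with that[OF elim] t0 show ?case by (simp add: \<theta>_def field_simps)
    qed
  qed
  show "(\<lambda>t. \<bar>f (x t) - f xs\<bar>) \<in> O(\<lambda>t. 1 / t powr (1 / \<delta>))"
    "(\<lambda>t. norm (A (x t) - b)) \<in> O(\<lambda>t. 1 / t powr (1 / \<delta>))"
    using K by (auto intro!: bigo)
qed

end
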